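(* Suppose that for every $i\in[N]$ and $t\in[T]$ the desired demand satisfies $\bar{x}_i^t=d_i\alpha^t$, where $\alpha^t\ge0$ for all $t\in[T]$ and $\sum_{t\in[T]}\alpha^t=1$, and suppose that $a^t=a^{t'}$ for all $t,t'\in[T]$. Let $\mathcal{C}\subset[N]$ be a coalition, let $x^\dagger$ be the $\mathcal{C}$-Nash equilibrium and let $x^\ast$ be the Nash equilibrium of the charging game. Then any group $\mathcal{S}\subseteq[N]$ incurs a lower cost in Nash equilibrium compared to $\mathcal{C}$-Nash equilibrium, i.e. $\sum_{i\in\mathcal{S}}c_i(x^\ast)\le\sum_{i\in\mathcal{S}}c_i(x^\dagger)$, if and only if $$\sum_{i\in\mathcal{S}}\left(f_i^\dagger(\mu,b,d)-f_i^\ast(\mu,b,d)\right)\ge0,$$ where for every $i\in[N]$ $$f_i^\dagger(\mu,b,d):=\Delta^\dagger\Delta_i^\dagger+\frac{\mu_i(\Delta_i^\dagger-d_i)^2}{2b},\qquad f_i^\ast(\mu,b,d):=\Delta^\ast\Delta_i^\ast+\frac{\mu_i(\Delta_i^\ast-d_i)^2}{2b},$$ $$\Delta_i^\dagger:=\left(\left(b(\mathbf{1}_N\mathbf{1}_N^\top+\mathbf{C})+\mu\right)^{-1}\mu d\right)_i,\qquad \Delta_i^\ast:=\left(\left(b(\mathbf{1}_N\mathbf{1}_N^\top+I_N)+\mu\right)^{-1}\mu d\right)_i,$$ and $\Delta^\dagger:=\sum_{i\in[N]}\Delta_i^\dagger$, $\Delta^\ast:=\sum_{i\in[N]}\Del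ta_i^\ast$.
   Context: For a positive integer $m$, $[m]=\{1,\dots,m\}$; $\mathbf{1}_N\in\mathbb{R}^N$ is the all-ones vector; $I_N$ is the identity matrix; $\|\cdot\|$ is the Euclidean norm. Charging game: there are $N$ charging stations and $T$ time steps. Station $i\in[N]$ has a nominal (desired) charging profile $\bar{x}_i=(\bar{x}_i^t)_{t\in[T]}\in\mathbb{R}^T$ with total demand $d_i=\sum_{t\in[T]}\bar{x}_i^t$, and sensitivity parameter $\mu_i>0$. Its feasible set is $X_i=\{x_i\in\mathbb{R}^T:\sum_{t\in[T]}x_i^t=d_i\}$ (no sign constraints), and $X=\prod_{i\in[N]}X_i$. For a joint profile $x=(x_i^t)_{i\in[N],t\in[T]}$, write $x^t=(x_i^t)_{i\in[N]}\in\mathbb{R}^N$, and $d=(d_i)_{i\in[N]}\in\mathbb{R}^N$. The price at time $t$ is $p^t(x)=a^t+b\,\mathbf{1}_N^\top x^t$ with $a^t>0$ and $b>0$. The cost of station $i$ is $$c_i(x)=\sum_{t\in[T]}p^t(x)x_i^t+\frac{\mu_i}{2}\|x_i-\bar{x}_i\|^2.$$ A joint profile $x^\ast\in X$ is a Nash equilibrium if $c_i(x_i^\ast,x_{-i}^\ast)\le c_i(x_i,x_{-i}^\ast)$ for every $i\in[N]$ and $x_i\in X_i$. For a coalition $\mathcal{C}\subset[N]$, $x^\dagger\in X$ is a $\mathcal{C}$-Nash equilibrium if (i) $\sum_{i\in\mathcal{C}}c_i(x^\dagger)\le\sum_{i\in\mathcal{C}}c_i(x'_{\mathcal{C}},x^\dagger_{-\mathcal{C}})$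 for every $x'_{\mathcal{C}}\in\prod_{j\in\mathcal{C}}X_j$, and (ii) $c_i(x^\dagger)\le c_i(x_i',x^\dagger_{-i})$ for every $i\notin\mathcal{C}$ and every $x_i'\in X_i$. Here $x_{-\mathcal{C}}$ (resp. $x_{-i}$) denotes the profiles of stations not in $\mathcal{C}$ (resp. other than $i$). Both equilibria exist and are unique. Matrices: $\mu=\mathrm{diag}(\mu_1,\dots,\mu_N)$, and $\mathbf{C}\in\mathbb{R}^{N\times N}$ has $\mathbf{C}_{ij}=1$ if $i,j\in\mathcal{C}$ or if $i=j\notin\mathcal{C}$, and $\mathbf{C}_{ij}=0$ otherwise.
   Formalization: The "if and only if" fails when all α^t are equal (costs then coincide while the f-sum can be negative); the formal theorem proves that f-sum ≥ 0 implies the cost inequality always, and the full equivalence when α is not constant. *)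

theory Defs
  imports "HOL-Analysis.Analysis"
begin

text \<open>
  Stations are the elements of the finite type \<open>'n\<close>, time steps those of the finite type \<open>'t\<close>.
  A joint profile is \<open>x :: real^'t^'n\<close>, so \<open>x $ i\<close> is the profile of station \<open>i\<close> and
  \<open>x $ i $ t\<close> its charge at time \<open>t\<close>.
\<close>

definition demand :: "real^'t^'n \<Rightarrow> real^'n" where
  "demand xbar = (\<chi> i. \<Sum>t\<in>UNIV. xbar $ i $ t)"

definition feasible :: "real^'t^'n \<Rightarrow> 'n \<Rightarrow> (real^'t) set" where
  "feasible xbar i = {y. (\<Sum>t\<in>UNIV. y $ t) = demand xbar $ i}"

definition joint_feasible :: "real^'t^'n \<Rightarrow> (real^'t^'n) set" where
  "joint_feasible xbar = {x. \<forall>i. x $ i \<in> feasible xbar i}"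

definition price :: "real^'t \<Rightarrow> real \<Rightarrow> real^'t^'n \<Rightarrow> 't \<Rightarrow> real" where
  "price a b x t = a $ t + b * (\<Sum>j\<in>UNIV. x $ j $ t)"

definition cost ::
  "real^'t \<Rightarrow> real \<Rightarrow> real^'n \<Rightarrow> real^'t^'n \<Rightarrow> 'n \<Rightarrow> real^'t^'n \<Rightarrow> real" where
  "cost a b \<mu> xbar i x =
     (\<Sum>t\<in>UNIV. price a b x t * x $ i $ t) + \<mu> $ i / 2 * (norm (x $ i - xbar $ i))\<^sup>2"

definition deviate :: "real^'t^'n \<Rightarrow> 'n \<Rightarrow> real^'t \<Rightarrow> real^'t^'n" where
  "deviate x i y = (\<chi> j. if j = i then y else x $ j)"

text \<open>Only the components \<open>y $ j\<close> with \<open>j \<in> C\<close> matter in the following joint deviation.\<close>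

definition deviate_coalition :: "real^'t^'n \<Rightarrow> 'n set \<Rightarrow> real^'t^'n \<Rightarrow> real^'t^'n" where
  "deviate_coalition x C y = (\<chi> j. if j \<in> C then y $ j else x $ j)"

definition nash_equilibrium ::
  "real^'t \<Rightarrow> real \<Rightarrow> real^'n \<Rightarrow> real^'t^'n \<Rightarrow> real^'t^'n \<Rightarrow> bool" where
  "nash_equilibrium a b \<mu> xbar x \<longleftrightarrow>
     x \<in> joint_feasible xbar \<and>
     (\<forall>i. \<forall>y \<in> feasible xbar i. cost a b \<mu> xbar i x \<le> cost a b \<mu> xbar i (deviate x i y))"

definition coalition_nash_equilibrium ::
  "real^'t \<Rightarrow> real \<Rightarrow> real^'n \<Rightarrow> real^'t^'n \<Rightarrow> 'n set \<Rightarrow> real^'t^'n \<Rightarrow> bool" where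
  "coalition_nash_equilibrium a b \<mu> xbar C x \<longleftrightarrow>
     x \<in> joint_feasible xbar \<and>
     (\<forall>y. (\<forall>j\<in>C. y $ j \<in> feasible xbar j) \<longrightarrow>
        (\<Sum>i\<in>C. cost a b \<mu> xbar i x) \<le>
        (\<Sum>i\<in>C. cost a b \<mu> xbar i (deviate_coalition x C y))) \<and>
     (\<forall>i. i \<notin> C \<longrightarrow> (\<forall>y \<in> feasible xbar i.
        cost a b \<mu> xbar i x \<le> cost a b \<mu> xbar i (deviate x i y)))"

definition diag_matrix :: "real^'n \<Rightarrow> real^'n^'n" where
  "diag_matrix v = (\<chi> i j. if i = j then v $ i else 0)"

definition ones_matrix :: "real^'n^'n" where
  "ones_matrix = (\<chi> i j. 1)"

definition coalition_matrix :: "'n set \<Rightarrow> real^'n^'n" where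
  "coalition_matrix C = (\<chi> i j. if i \<in> C \<and> j \<in> C \<or> i = j \<and> j \<notin> C then 1 else 0)"

definition Delta_dagger :: "real^'n \<Rightarrow> real \<Rightarrow> real^'n \<Rightarrow> 'n set \<Rightarrow> real^'n" where
  "Delta_dagger \<mu> b d C =
     matrix_inv (b *\<^sub>R (ones_matrix + coalition_matrix C) + diag_matrix \<mu>) *v (diag_matrix \<mu> *v d)"

definition Delta_star :: "real^'n \<Rightarrow> real \<Rightarrow> real^'n \<Rightarrow> real^'n" where
  "Delta_star \<mu> b d =
     matrix_inv (b *\<^sub>R (ones_matrix + mat 1) + diag_matrix \<mu>) *v (diag_matrix \<mu> *v d)"

definition f_dagger :: "real^'n \<Rightarrow> real \<Rightarrow> real^'n \<Rightarrow> 'n set \<Rightarrow> 'n \<Rightarrow> real" where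
  "f_dagger \<mu> b d C i =
     (\<Sum>j\<in>UNIV. Delta_dagger \<mu> b d C $ j) * Delta_dagger \<mu> b d C $ i
     + \<mu> $ i * (Delta_dagger \<mu> b d C $ i - d $ i)\<^sup>2 / (2 * b)"

definition f_star :: "real^'n \<Rightarrow> real \<Rightarrow> real^'n \<Rightarrow> 'n \<Rightarrow> real" where
  "f_star \<mu> b d i =
     (\<Sum>j\<in>UNIV. Delta_star \<mu> b d $ j) * Delta_star \<mu> b d $ i
     + \<mu> $ i * (Delta_star \<mu> b d $ i - d $ i)\<^sup>2 / (2 * b)"

end

theory Submission
  imports Defs
begin

text \<open>
  With a time-independent base price, time enters the game only through the profile
  \<open>\<alpha>\<close>. Write \<open>T\<close> for the number of time steps, \<open>d\<close> for the demands and
  \<open>\<beta>\<^sup>t = \<alpha>\<^sup>t - 1/T\<close>. In an equilibrium no feasible deviation, i.e. no change of a profile with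
  zero sum over time, lowers the cost of the player who controls it. Hence the gradient of that cost
  is constant in time (\<open>constant_if_nonnegative_on_zero_sum\<close>). Subtracting the time average from this
  linear condition cancels the multipliers and leaves
  \<open>M (x\<^sup>t - d/T) = \<beta>\<^sup>t \<mu> d\<close> with \<open>M = b (1 1\<^sup>T + C) + \<mu>\<close>. As \<open>M\<close> is positive definite,
  \<open>x\<^sup>t = d/T + \<beta>\<^sup>t \<Delta>\<close> with \<open>\<Delta> = M\<^sup>-\<^sup>1 \<mu> d\<close> (\<open>coalition_equilibrium_profile\<close>): every station takes its
  flat profile plus a multiple of the common fluctuation \<open>\<beta>\<close>.

  In the cost of such a profile the mixed terms vanish because \<open>\<beta>\<close> sums to zero, and what remains is
  a constant that is the same for every coalition, plus \<open>b (\<Sum>\<^sub>t (\<beta>\<^sup>t)\<^sup>2) f\<^sub>i\<close>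
  (\<open>coalition_equilibrium_cost\<close>). The Nash equilibrium is the case of the empty
  coalition, so the cost difference of the two equilibria is \<open>b (\<Sum>\<^sub>t (\<beta>\<^sup>t)\<^sup>2)\<close> times the
  difference of the \<open>f\<^sub>i\<close>. This factor is nonnegative, and positive as soon as \<open>\<alpha>\<close> is not constant.
\<close>

section \<open>First-order conditions\<close>

text \<open>A first-order condition that needs no differentiation: the deviation against
  \<open>g\<close>, made feasible by subtracting the mean of \<open>g\<close>, decreases the linear term by a multiple of the
  variance of \<open>g\<close>, and for small steps the quadratic term cannot make up for this.\<close>

lemma constant_if_nonnegative_on_zero_sum:
  fixes g :: "'t::finite \<Rightarrow> real"
  assumes "\<kappa> > 0"
    and nonneg: "\<And>h :: real^'t. (\<Sum>t\<in>UNIV. h $ t) = 0 \<Longrightarrow>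
      0 \<le> (\<Sum>t\<in>UNIV. h $ t * g t) + \<kappa> * (\<Sum>t\<in>UNIV. (h $ t)\<^sup>2)"
  shows "g t = (\<Sum>s\<in>UNIV. g s) / real CARD('t)"
proof -
  define m where "m = (\<Sum>s\<in>UNIV. g s) / real CARD('t)"
  define V where "V = (\<Sum>s\<in>UNIV. (g s - m)\<^sup>2)"
  have zero_sum: "(\<Sum>s\<in>UNIV. g s - m) = 0"
    by (simp add: sum_subtractf m_def)
  \<comment> \<open>The step \<open>1/(2\<kappa>)\<close> minimises \<open>- s V + \<kappa> s\<^sup>2 V\<close>.\<close>
  define h :: "real^'t" where "h = (\<chi> s. - 1 / (2 * \<kappa>) * (g s - m))"
  have h_feasible: "(\<Sum>s\<in>UNIV. h $ s) = 0"
    unfolding h_def vec_lambda_beta sum_distrib_left[symmetric] zero_sum by simp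
  have "(\<Sum>s\<in>UNIV. h $ s * g s) = (\<Sum>s\<in>UNIV. h $ s * (g s - m)) + m * (\<Sum>s\<in>UNIV. h $ s)"
    by (simp add: sum_distrib_left sum.distrib[symmetric] algebra_simps)
  also have "\<dots> = - V / (2 * \<kappa>)"
    unfolding h_feasible V_def
    by (simp add: h_def sum_divide_distrib sum_negf[symmetric] power2_eq_square)
  finally have linear: "(\<Sum>s\<in>UNIV. h $ s * g s) = - V / (2 * \<kappa>)" .
  have "(\<Sum>s\<in>UNIV. (h $ s)\<^sup>2) = (- 1 / (2 * \<kappa>))\<^sup>2 * V"
    unfolding h_def V_def vec_lambda_beta power_mult_distrib sum_distrib_left ..
  then have quadratic: "\<kappa> * (\<Sum>s\<in>UNIV. (h $ s)\<^sup>2) = V / (4 * \<kappa>)"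
    using \<open>\<kappa> > 0\<close> by (simp add: power2_eq_square)
  have "0 \<le> - V / (2 * \<kappa>) + V / (4 * \<kappa>)"
    using nonneg[OF h_feasible] unfolding linear quadratic .
  then have "V \<le> 0"
    using \<open>\<kappa> > 0\<close> by (simp add: field_simps)
  then have "V = 0"
    by (simp add: V_def sum_nonneg order_antisym)
  then have "(g t - m)\<^sup>2 = 0"
    unfolding V_def by (subst (asm) sum_nonneg_eq_0_iff) auto
  then show ?thesis
    by (simp add: m_def)
qed

lemma norm_sq_vec: "(norm v)\<^sup>2 = (\<Sum>t\<in>UNIV. (v $ t)\<^sup>2)" for v :: "real^'t"
  unfolding power2_norm_eq_inner by (simp add: inner_vec_def power2_eq_square)

text \<open>The stations whose total cost the player controlling station \<open>i\<close> minimises. With this, the two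
  equilibrium conditions become one condition on all stations.\<close>

definition bloc :: "'n set \<Rightarrow> 'n \<Rightarrow> 'n set" where
  "bloc C i = (if i \<in> C then C else {i})"

lemma mem_bloc [simp]: "i \<in> bloc C i"
  by (simp add: bloc_def)

lemma coalition_equilibrium_bloc_cost_le:
  assumes "coalition_nash_equilibrium a b \<mu> xbar C x" and "y \<in> feasible xbar i"
  shows "(\<Sum>k\<in>bloc C i. cost a b \<mu> xbar k x)
    \<le> (\<Sum>k\<in>bloc C i. cost a b \<mu> xbar k (deviate x i y))"
proof (cases "i \<in> C")
  case True
  have "deviate_coalition x C (deviate x i y) = deviate x i y"
    using True by (auto simp: deviate_coalition_def deviate_def vec_eq_iff)
  moreover have "\<forall>j\<in>C. deviate x i y $ j \<in> feasible xbar j"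
    using assms by (auto simp: coalition_nash_equilibrium_def joint_feasible_def deviate_def)
  moreover have "\<forall>z. (\<forall>j\<in>C. z $ j \<in> feasible xbar j) \<longrightarrow>
      (\<Sum>k\<in>C. cost a b \<mu> xbar k x) \<le> (\<Sum>k\<in>C. cost a b \<mu> xbar k (deviate_coalition x C z))"
    using assms(1) by (simp add: coalition_nash_equilibrium_def)
  ultimately have "(\<Sum>k\<in>C. cost a b \<mu> xbar k x) \<le> (\<Sum>k\<in>C. cost a b \<mu> xbar k (deviate x i y))"
    by (elim allE[of _ "deviate x i y"]) simp
  then show ?thesis
    using True by (simp add: bloc_def)
next
  case False
  then show ?thesis
    using assms by (simp add: coalition_nash_equilibrium_def bloc_def)
qed

text \<open>The other stations feel a deviation of station \<open>i\<close> through the price only, hence linearly.\<close>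

lemma cost_deviate:
  fixes x xbar :: "real^'t^'n"
  shows "cost a b \<mu> xbar k (deviate x i (x $ i + h)) = cost a b \<mu> xbar k x
    + b * (\<Sum>t\<in>UNIV. h $ t * x $ k $ t)
    + (if k = i then (\<Sum>t\<in>UNIV. h $ t * (price a b x t + \<mu> $ i * (x $ i $ t - xbar $ i $ t)))
         + (b + \<mu> $ i / 2) * (\<Sum>t\<in>UNIV. (h $ t)\<^sup>2) else 0)"
proof -
  have total: "(\<Sum>j\<in>UNIV. deviate x i (x $ i + h) $ j $ t) = (\<Sum>j\<in>UNIV. x $ j $ t) + h $ t" for t
  proof -
    have "(\<Sum>j\<in>UNIV. deviate x i (x $ i + h) $ j $ t)
        = (\<Sum>j\<in>UNIV. x $ j $ t + (if j = i then h $ t else 0))"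
      by (intro sum.cong) (auto simp: deviate_def)
    then show ?thesis
      by (simp add: sum.distrib)
  qed
  have price: "price a b (deviate x i (x $ i + h)) t = price a b x t + b * h $ t" for t
    unfolding price_def total by (simp add: algebra_simps)
  show ?thesis
  proof (cases "k = i")
    case True
    have charge: "(\<Sum>t\<in>UNIV. (price a b x t + b * h $ t) * (x $ i $ t + h $ t))
        = (\<Sum>t\<in>UNIV. price a b x t * x $ i $ t) + b * (\<Sum>t\<in>UNIV. h $ t * x $ i $ t)
          + (\<Sum>t\<in>UNIV. h $ t * price a b x t) + b * (\<Sum>t\<in>UNIV. (h $ t)\<^sup>2)"
      unfolding sum_distrib_left sum.distrib[symmetric]
      by (intro sum.cong) (simp_all add: algebra_simps power2_eq_square)
    have "(\<Sum>t\<in>UNIV. (x $ i $ t + h $ t - xbar $ i $ t)\<^sup>2)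
        = (\<Sum>t\<in>UNIV. (x $ i $ t - xbar $ i $ t)\<^sup>2
            + 2 * (h $ t * (x $ i $ t - xbar $ i $ t)) + (h $ t)\<^sup>2)"
      by (intro sum.cong) (simp_all add: algebra_simps power2_eq_square)
    then have penalty: "(\<Sum>t\<in>UNIV. (x $ i $ t + h $ t - xbar $ i $ t)\<^sup>2)
        = (\<Sum>t\<in>UNIV. (x $ i $ t - xbar $ i $ t)\<^sup>2)
          + 2 * (\<Sum>t\<in>UNIV. h $ t * (x $ i $ t - xbar $ i $ t)) + (\<Sum>t\<in>UNIV. (h $ t)\<^sup>2)"
      by (simp add: sum.distrib sum_distrib_left)
    have linear: "(\<Sum>t\<in>UNIV. h $ t * (price a b x t + \<mu> $ i * (x $ i $ t - xbar $ i $ t)))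
        = (\<Sum>t\<in>UNIV. h $ t * price a b x t)
          + \<mu> $ i * (\<Sum>t\<in>UNIV. h $ t * (x $ i $ t - xbar $ i $ t))"
      unfolding sum_distrib_left sum.distrib[symmetric] by (simp add: distrib_left mult.left_commute)
    have dev: "deviate x i (x $ i + h) $ i = x $ i + h"
      by (simp add: deviate_def)
    show ?thesis
      unfolding True cost_def price norm_sq_vec dev vector_add_component vector_minus_component
        charge penalty linear
      by (simp add: algebra_simps)
  next
    case False
    then have "deviate x i (x $ i + h) $ k = x $ k"
      by (simp add: deviate_def)
    moreover have "(\<Sum>t\<in>UNIV. (price a b x t + b * h $ t) * x $ k $ t)
        = (\<Sum>t\<in>UNIV. price a b x t * x $ k $ t) + b * (\<Sum>t\<in>UNIV. h $ t * x $ k $ t)"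
      by (simp add: distrib_right sum.distrib sum_distrib_left mult.assoc)
    ultimately show ?thesis
      using False by (simp add: cost_def price)
  qed
qed

text \<open>\<open>g t\<close> is the marginal cost, to the bloc of station \<open>i\<close>, of charging at time \<open>t\<close>. Besides the
  price and the marginal penalty it contains the price increase paid on the whole load of the
  bloc; this last term is the only place where the coalition enters.\<close>

lemma coalition_equilibrium_gradient_constant:
  fixes x xbar :: "real^'t^'n"
  assumes eq: "coalition_nash_equilibrium a b \<mu> xbar C x"
    and b: "b > 0" and \<mu>: "\<mu> $ i > 0"
  defines "g \<equiv> \<lambda>t. price a b x t + \<mu> $ i * (x $ i $ t - xbar $ i $ t) + b * (\<Sum>k\<in>bloc C i. x $ k $ t)"
  shows "g t = (\<Sum>s\<in>UNIV. g s) / real CARD('t)"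
proof (rule constant_if_nonnegative_on_zero_sum)
  show "b + \<mu> $ i / 2 > 0"
    using b \<mu> by simp
  fix h :: "real^'t"
  assume "(\<Sum>t\<in>UNIV. h $ t) = 0"
  then have "x $ i + h \<in> feasible xbar i"
    using eq by (simp add: coalition_nash_equilibrium_def joint_feasible_def feasible_def sum.distrib)
  from coalition_equilibrium_bloc_cost_le[OF eq this]
  have "0 \<le> (\<Sum>k\<in>bloc C i. b * (\<Sum>t\<in>UNIV. h $ t * x $ k $ t))
    + ((\<Sum>t\<in>UNIV. h $ t * (price a b x t + \<mu> $ i * (x $ i $ t - xbar $ i $ t)))
      + (b + \<mu> $ i / 2) * (\<Sum>t\<in>UNIV. (h $ t)\<^sup>2))"
    by (simp add: cost_deviate sum.distrib)
  moreover have "(\<Sum>k\<in>bloc C i. b * (\<Sum>t\<in>UNIV. h $ t * x $ k $ t))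
      = (\<Sum>t\<in>UNIV. h $ t * (b * (\<Sum>k\<in>bloc C i. x $ k $ t)))"
    unfolding sum_distrib_left by (subst sum.swap) (simp add: mult_ac)
  ultimately show "0 \<le> (\<Sum>t\<in>UNIV. h $ t * g t) + (b + \<mu> $ i / 2) * (\<Sum>t\<in>UNIV. (h $ t)\<^sup>2)"
    unfolding g_def by (simp add: distrib_left sum.distrib)
qed

section \<open>The equilibrium matrix\<close>

definition equilibrium_matrix :: "real^'n \<Rightarrow> real \<Rightarrow> 'n set \<Rightarrow> real^'n^'n" where
  "equilibrium_matrix \<mu> b C = b *\<^sub>R (ones_matrix + coalition_matrix C) + diag_matrix \<mu>"

lemma diag_matrix_mult_vec: "(diag_matrix \<mu> *v v) $ i = \<mu> $ i * v $ i"
  by (simp add: matrix_vector_mult_def diag_matrix_def if_distrib[of "\<lambda>c. c * _"] cong: if_cong)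

lemma coalition_matrix_mult_vec: "(coalition_matrix C *v v) $ i = (\<Sum>k\<in>bloc C i. v $ k)"
proof -
  have "(coalition_matrix C *v v) $ i = (\<Sum>k\<in>UNIV. if k \<in> bloc C i then v $ k else 0)"
  proof -
    have "coalition_matrix C $ i $ k = (if k \<in> bloc C i then 1 else 0)" for k
      by (auto simp: coalition_matrix_def bloc_def)
    then show ?thesis
      by (simp add: matrix_vector_mult_def if_distrib[of "\<lambda>c. c * _"] cong: if_cong)
  qed
  then show ?thesis
    by (simp add: sum.If_cases)
qed

lemma equilibrium_matrix_mult_vec:
  "(equilibrium_matrix \<mu> b C *v v) $ i
    = b * ((\<Sum>k\<in>UNIV. v $ k) + (\<Sum>k\<in>bloc C i. v $ k)) + \<mu> $ i * v $ i"
proof -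
  have "(ones_matrix *v v) $ i = (\<Sum>k\<in>UNIV. v $ k)"
    by (simp add: matrix_vector_mult_def ones_matrix_def)
  then show ?thesis
    unfolding equilibrium_matrix_def
    by (simp add: matrix_vector_mult_add_rdistrib scaleR_matrix_vector_assoc[symmetric]
        diag_matrix_mult_vec coalition_matrix_mult_vec)
qed

text \<open>The quadratic form of the matrix is \<open>b ((\<Sum>v)\<^sup>2 + (\<Sum>\<^sub>C v)\<^sup>2 + \<Sum>\<^sub>-\<^sub>C v\<^sup>2) + \<Sum>\<mu> v\<^sup>2\<close>, which is
  positive for \<open>v \<noteq> 0\<close>.\<close>

lemma invertible_equilibrium_matrix:
  fixes \<mu> :: "real^'n"
  assumes b: "b > 0" and \<mu>: "\<forall>i. \<mu> $ i > 0"
  shows "invertible (equilibrium_matrix \<mu> b C)"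
proof -
  have "v = 0" if ker: "equilibrium_matrix \<mu> b C *v v = 0" for v :: "real^'n"
  proof -
    have bloc_form: "(\<Sum>i\<in>UNIV. v $ i * (\<Sum>k\<in>bloc C i. v $ k))
        = (\<Sum>k\<in>C. v $ k)\<^sup>2 + (\<Sum>i\<in>-C. (v $ i)\<^sup>2)"
    proof -
      have "(\<Sum>i\<in>UNIV. v $ i * (\<Sum>k\<in>bloc C i. v $ k))
          = (\<Sum>i\<in>UNIV. if i \<in> C then v $ i * (\<Sum>k\<in>C. v $ k) else (v $ i)\<^sup>2)"
        by (intro sum.cong) (auto simp: bloc_def power2_eq_square)
      also have "\<dots> = (\<Sum>i\<in>C. v $ i * (\<Sum>k\<in>C. v $ k)) + (\<Sum>i\<in>-C. (v $ i)\<^sup>2)"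
        by (simp add: sum.If_cases)
      finally show ?thesis
        by (simp add: power2_eq_square sum_distrib_right)
    qed
    have "0 = (\<Sum>i\<in>UNIV. v $ i * (equilibrium_matrix \<mu> b C *v v) $ i)"
      by (simp add: ker)
    also have "\<dots> = b * ((\<Sum>k\<in>UNIV. v $ k)\<^sup>2 + (\<Sum>i\<in>UNIV. v $ i * (\<Sum>k\<in>bloc C i. v $ k)))
        + (\<Sum>i\<in>UNIV. \<mu> $ i * (v $ i)\<^sup>2)"
      unfolding equilibrium_matrix_mult_vec power2_eq_square
        sum_distrib_right[of "\<lambda>k. v $ k" UNIV "\<Sum>k\<in>UNIV. v $ k"] sum.distrib[symmetric]
        sum_distrib_left[of b]
      by (intro sum.cong) (simp_all add: algebra_simps)
    finally have "(\<Sum>i\<in>UNIV. \<mu> $ i * (v $ i)\<^sup>2)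
        = - (b * ((\<Sum>k\<in>UNIV. v $ k)\<^sup>2 + ((\<Sum>k\<in>C. v $ k)\<^sup>2 + (\<Sum>i\<in>-C. (v $ i)\<^sup>2))))"
      unfolding bloc_form by linarith
    also have "\<dots> \<le> 0"
      using b by (simp add: sum_nonneg)
    finally have "(\<Sum>i\<in>UNIV. \<mu> $ i * (v $ i)\<^sup>2) = 0"
      using \<mu> by (intro order_antisym sum_nonneg) (auto simp: less_imp_le)
    then have "\<forall>i\<in>UNIV. \<mu> $ i * (v $ i)\<^sup>2 = 0"
      using \<mu> by (subst (asm) sum_nonneg_eq_0_iff) (auto simp: less_imp_le)
    then show "v = 0"
      using \<mu> by (auto simp: vec_eq_iff less_le)
  qed
  then show ?thesis
    by (simp add: invertible_left_inverse matrix_left_invertible_ker)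
qed

lemma Delta_dagger_unique:
  fixes \<mu> d v :: "real^'n"
  assumes "b > 0" and "\<forall>i. \<mu> $ i > 0"
    and "equilibrium_matrix \<mu> b C *v v = c *\<^sub>R (diag_matrix \<mu> *v d)"
  shows "v = c *\<^sub>R Delta_dagger \<mu> b d C"
proof -
  let ?M = "equilibrium_matrix \<mu> b C"
  have "v = matrix_inv ?M *v (?M *v v)"
  proof -
    have "matrix_inv ?M ** ?M = mat 1"
      using someI_ex[OF invertible_equilibrium_matrix[OF assms(1,2), of C, unfolded invertible_def]]
      by (simp add: matrix_inv_def)
    then show ?thesis
      by (simp add: matrix_vector_mul_assoc)
  qed
  also have "\<dots> = c *\<^sub>R (matrix_inv ?M *v (diag_matrix \<mu> *v d))"
    unfolding assms(3) by (simp add: matrix_vector_mult_scaleR)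
  finally show ?thesis
    by (simp add: Delta_dagger_def equilibrium_matrix_def)
qed

section \<open>Equilibrium profiles and costs\<close>

text \<open>The time average of the condition \<open>M x\<^sup>t + a 1 = \<alpha>\<^sup>t \<mu> d + \<lambda>\<close> determines the multiplier
  \<open>\<lambda>\<close>; subtracting it leaves a linear system for the deviation from the flat profile.\<close>

lemma coalition_equilibrium_profile:
  fixes a \<alpha> :: "real^'t" and x xbar :: "real^'t^'n"
  assumes b: "b > 0" and \<mu>: "\<forall>i. \<mu> $ i > 0"
    and alpha_sum: "(\<Sum>t\<in>UNIV. \<alpha> $ t) = 1"
    and xbar: "\<forall>i t. xbar $ i $ t = demand xbar $ i * \<alpha> $ t"
    and a: "\<forall>t. a $ t = a\<^sub>0"
    and eq: "coalition_nash_equilibrium a b \<mu> xbar C x"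
  shows "x $ i $ t = demand xbar $ i / real CARD('t)
    + (\<alpha> $ t - 1 / real CARD('t)) * Delta_dagger \<mu> b (demand xbar) C $ i"
proof -
  let ?T = "real CARD('t)" and ?d = "demand xbar"
  define v where "v = (\<chi> i. x $ i $ t - ?d $ i / ?T)"
  have row_sum: "(\<Sum>s\<in>UNIV. x $ j $ s) = ?d $ j" for j
    using eq by (simp add: coalition_nash_equilibrium_def joint_feasible_def feasible_def)
  have "(equilibrium_matrix \<mu> b C *v v) $ i = ((\<alpha> $ t - 1 / ?T) *\<^sub>R (diag_matrix \<mu> *v ?d)) $ i" for i
  proof -
    let ?g = "\<lambda>t. price a b x t + \<mu> $ i * (x $ i $ t - xbar $ i $ t) + b * (\<Sum>k\<in>bloc C i. x $ k $ t)"
    have swap: "(\<Sum>s\<in>UNIV. \<Sum>k\<in>K. x $ k $ s) = (\<Sum>k\<in>K. ?d $ k)" for K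
      by (subst sum.swap) (simp add: row_sum)
    have "(\<Sum>s\<in>UNIV. ?g s) = ?T * a\<^sub>0 + b * (\<Sum>k\<in>UNIV. ?d $ k)
        + \<mu> $ i * (?d $ i - ?d $ i * (\<Sum>s\<in>UNIV. \<alpha> $ s)) + b * (\<Sum>k\<in>bloc C i. ?d $ k)"
    proof -
      have "(\<Sum>s\<in>UNIV. a $ s) = ?T * a\<^sub>0"
        using a by simp
      moreover have "(\<Sum>s\<in>UNIV. xbar $ i $ s) = ?d $ i * (\<Sum>s\<in>UNIV. \<alpha> $ s)"
        using xbar by (simp add: sum_distrib_left)
      ultimately show ?thesis
        by (simp add: price_def sum.distrib sum_subtractf sum_distrib_left[symmetric] swap row_sum)
    qed
    also have "\<dots> = ?T * a\<^sub>0 + b * ((\<Sum>k\<in>UNIV. ?d $ k) + (\<Sum>k\<in>bloc C i. ?d $ k))"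
      by (simp add: alpha_sum algebra_simps)
    finally have "?g t = a\<^sub>0 + b * ((\<Sum>k\<in>UNIV. ?d $ k) + (\<Sum>k\<in>bloc C i. ?d $ k)) / ?T"
      using coalition_equilibrium_gradient_constant[OF eq b, of i t] \<mu>
      by (simp add: add_divide_distrib)
    moreover have "xbar $ i $ t = ?d $ i * \<alpha> $ t"
      using xbar by blast
    moreover have "(\<Sum>k\<in>K. v $ k) = (\<Sum>k\<in>K. x $ k $ t) - (\<Sum>k\<in>K. ?d $ k) / ?T" for K
      by (simp add: v_def sum_subtractf sum_divide_distrib)
    ultimately show ?thesis
      by (simp add: equilibrium_matrix_mult_vec diag_matrix_mult_vec price_def a)
        (simp add: v_def algebra_simps add_divide_distrib)
  qed
  then have "equilibrium_matrix \<mu> b C *v v = (\<alpha> $ t - 1 / ?T) *\<^sub>R (diag_matrix \<mu> *v ?d)"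
    by (simp add: vec_eq_iff)
  then have "v = (\<alpha> $ t - 1 / ?T) *\<^sub>R Delta_dagger \<mu> b ?d C"
    by (rule Delta_dagger_unique[OF b \<mu>])
  then have "v $ i = (\<alpha> $ t - 1 / ?T) * Delta_dagger \<mu> b ?d C $ i"
    by simp
  then show ?thesis
    by (simp add: v_def)
qed

lemma coalition_equilibrium_cost:
  fixes a \<alpha> :: "real^'t" and x xbar :: "real^'t^'n"
  assumes b: "b > 0" and \<mu>: "\<forall>i. \<mu> $ i > 0"
    and alpha_sum: "(\<Sum>t\<in>UNIV. \<alpha> $ t) = 1"
    and xbar: "\<forall>i t. xbar $ i $ t = demand xbar $ i * \<alpha> $ t"
    and a: "\<forall>t. a $ t = a\<^sub>0"
    and eq: "coalition_nash_equilibrium a b \<mu> xbar C x"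
  shows "cost a b \<mu> xbar i x
    = (a\<^sub>0 + b * (\<Sum>j\<in>UNIV. demand xbar $ j) / real CARD('t)) * demand xbar $ i
      + b * (\<Sum>t\<in>UNIV. (\<alpha> $ t - 1 / real CARD('t))\<^sup>2) * f_dagger \<mu> b (demand xbar) C i"
proof -
  let ?T = "real CARD('t)" and ?d = "demand xbar"
  let ?\<Delta> = "Delta_dagger \<mu> b ?d C"
  define \<beta> where "\<beta> t = \<alpha> $ t - 1 / ?T" for t
  define D where "D = (\<Sum>j\<in>UNIV. ?d $ j)"
  define E where "E = (\<Sum>j\<in>UNIV. ?\<Delta> $ j)"
  define p where "p = a\<^sub>0 + b * D / ?T"
  have beta_sum: "(\<Sum>t\<in>UNIV. \<beta> t) = 0"
    by (simp add: \<beta>_def sum_subtractf alpha_sum)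
  have x: "x $ j $ t = ?d $ j / ?T + \<beta> t * ?\<Delta> $ j" for j t
    unfolding \<beta>_def by (rule coalition_equilibrium_profile[OF assms])
  have price: "price a b x t = p + b * E * \<beta> t" for t
    by (simp add: price_def a x sum.distrib sum_divide_distrib[symmetric]
        sum_distrib_left[symmetric] p_def D_def E_def algebra_simps)
  have dev: "(x $ i - xbar $ i) $ t = \<beta> t * (?\<Delta> $ i - ?d $ i)" for t
    using xbar by (simp add: x \<beta>_def algebra_simps)
  have "cost a b \<mu> xbar i x
      = (\<Sum>t\<in>UNIV. (p + b * E * \<beta> t) * (?d $ i / ?T + \<beta> t * ?\<Delta> $ i))
        + \<mu> $ i / 2 * (\<Sum>t\<in>UNIV. (\<beta> t * (?\<Delta> $ i - ?d $ i))\<^sup>2)"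
    unfolding cost_def norm_sq_vec dev price x ..
  also have "(\<Sum>t\<in>UNIV. (p + b * E * \<beta> t) * (?d $ i / ?T + \<beta> t * ?\<Delta> $ i))
      = (\<Sum>t\<in>UNIV. p * ?d $ i / ?T + (p * ?\<Delta> $ i + b * E * ?d $ i / ?T) * \<beta> t
          + b * E * ?\<Delta> $ i * (\<beta> t)\<^sup>2)"
    by (intro sum.cong) (simp_all add: field_simps power2_eq_square)
  also have "\<dots> = p * ?d $ i + b * E * ?\<Delta> $ i * (\<Sum>t\<in>UNIV. (\<beta> t)\<^sup>2)"
    by (simp add: sum.distrib sum_distrib_left[symmetric] beta_sum)
  also have "(\<Sum>t\<in>UNIV. (\<beta> t * (?\<Delta> $ i - ?d $ i))\<^sup>2)
      = (?\<Delta> $ i - ?d $ i)\<^sup>2 * (\<Sum>t\<in>UNIV. (\<beta> t)\<^sup>2)"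
    unfolding power_mult_distrib sum_distrib_right[symmetric] by (rule mult.commute)
  finally show ?thesis
    using b by (simp add: f_dagger_def \<beta>_def[symmetric] p_def D_def[symmetric] E_def[symmetric]
        field_simps)
qed

section \<open>Comparison of the two equilibria\<close>

lemma nash_equilibrium_eq_empty_coalition:
  "nash_equilibrium a b \<mu> xbar x \<longleftrightarrow> coalition_nash_equilibrium a b \<mu> xbar {} x"
  by (simp add: nash_equilibrium_def coalition_nash_equilibrium_def)

lemma f_star_eq_empty_coalition:
  fixes \<mu> :: "real^'n"
  shows "f_star \<mu> b d i = f_dagger \<mu> b d {} i"
proof -
  have "coalition_matrix {} = (mat 1 :: real^'n^'n)"
    by (simp add: coalition_matrix_def mat_def)
  then have "Delta_star \<mu> b d = Delta_dagger \<mu> b d {}"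
    by (simp add: Delta_star_def Delta_dagger_def)
  then show ?thesis
    by (simp add: f_star_def f_dagger_def)
qed

theorem theorem2:
  fixes a :: "real^'t" and b :: real and \<mu> :: "real^'n"
    and xbar :: "real^'t^'n" and \<alpha> :: "real^'t"
    and C S :: "'n set" and x_dagger x_star :: "real^'t^'n"
  assumes a_pos: "\<forall>t. a $ t > 0"
    and b_pos: "b > 0"
    and mu_pos: "\<forall>i. \<mu> $ i > 0"
    and alpha_nonneg: "\<forall>t. \<alpha> $ t \<ge> 0"
    and alpha_sum: "(\<Sum>t\<in>UNIV. \<alpha> $ t) = 1"
    and xbar_alpha: "\<forall>i t. xbar $ i $ t = demand xbar $ i * \<alpha> $ t"
    and a_const: "\<forall>t t'. a $ t = a $ t'"
    and dagger: "coalition_nash_equilibrium a b \<mu> xbar C x_dagger"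
    and star: "nash_equilibrium a b \<mu> xbar x_star"
  shows
    "((\<Sum>i\<in>S. f_dagger \<mu> b (demand xbar) C i - f_star \<mu> b (demand xbar) i) \<ge> 0 \<longrightarrow>
        (\<Sum>i\<in>S. cost a b \<mu> xbar i x_star) \<le> (\<Sum>i\<in>S. cost a b \<mu> xbar i x_dagger))
     \<and> ((\<exists>t t'. \<alpha> $ t \<noteq> \<alpha> $ t') \<longrightarrow>
        ((\<Sum>i\<in>S. cost a b \<mu> xbar i x_star) \<le> (\<Sum>i\<in>S. cost a b \<mu> xbar i x_dagger) \<longleftrightarrow>
         (\<Sum>i\<in>S. f_dagger \<mu> b (demand xbar) C i - f_star \<mu> b (demand xbar) i) \<ge> 0))"
proof -
  define \<beta> where "\<beta> t = \<alpha> $ t - 1 / real CARD('t)" for t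
  define B where "B = b * (\<Sum>t\<in>UNIV. (\<beta> t)\<^sup>2)"
  let ?F = "\<Sum>i\<in>S. f_dagger \<mu> b (demand xbar) C i - f_star \<mu> b (demand xbar) i"
  obtain a\<^sub>0 where a: "\<forall>t. a $ t = a\<^sub>0"
    using a_const by blast
  note star' = star[unfolded nash_equilibrium_eq_empty_coalition]
  note cost_eq = coalition_equilibrium_cost[OF b_pos mu_pos alpha_sum xbar_alpha a]
  have "cost a b \<mu> xbar i x_dagger - cost a b \<mu> xbar i x_star
      = B * (f_dagger \<mu> b (demand xbar) C i - f_star \<mu> b (demand xbar) i)" for i
    unfolding cost_eq[OF dagger] cost_eq[OF star'] f_star_eq_empty_coalition B_def \<beta>_def
    by (simp only: right_diff_distrib add_diff_cancel_left)
  then have "(\<Sum>i\<in>S. cost a b \<mu> xbar i x_dagger) - (\<Sum>i\<in>S. cost a b \<mu> xbar i x_star) = B * ?F"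
    unfolding sum_subtractf[symmetric] sum_distrib_left by (simp only:)
  then have le_iff: "(\<Sum>i\<in>S. cost a b \<mu> xbar i x_star) \<le> (\<Sum>i\<in>S. cost a b \<mu> xbar i x_dagger)
      \<longleftrightarrow> 0 \<le> B * ?F"
    by linarith
  have B_nonneg: "B \<ge> 0"
    using b_pos by (simp add: B_def sum_nonneg)
  have B_pos: "B > 0" if "\<exists>t t'. \<alpha> $ t \<noteq> \<alpha> $ t'"
  proof -
    from that obtain t where "\<beta> t \<noteq> 0"
      unfolding \<beta>_def by (metis eq_iff_diff_eq_0)
    then have "(\<Sum>t\<in>UNIV. (\<beta> t)\<^sup>2) > 0"
      by (intro sum_pos2[of _ t]) auto
    then show ?thesis
      using b_pos by (simp add: B_def)
  qed
  show ?thesis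
    unfolding le_iff using B_nonneg B_pos by (auto simp: zero_le_mult_iff not_less)
qed

end
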